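(* Consider the saturated switched system $x(t+1)=A_{\sigma(t)}x(t)+B_{\sigma(t)}\,\mathrm{sat}(K_{\sigma(t)}x(t))$, $t\in\mathbb{Z}^+$, with $\sigma(t)\in\mathcal{I}_N=\{1,\dots,N\}$. Suppose that for some integer $\tau\ge1$ there exist symmetric positive definite matrices $Q_i\succ0$ in $\mathbb{R}^{n\times n}$ and matrices $Y_{i,1},\dots,Y_{i,\tau}\in\mathbb{R}^{m\times n}$, $i=1,\dots,N$, such that the following linear matrix inequalities hold ($*$ denotes the transpose of the off-diagonal block, and the matrices $\Theta_{i,r}$ are defined in the context): $$\begin{bmatrix}Q_i&*\\ \Theta_{i,0}(S_1)Q_i+\Theta_{i,1}(S_1)Y_{i,1}&Q_i\end{bmatrix}\succ0\qquad\forall i\in\mathcal{I}_N,\ \forall S_1\in\mathcal{V}_m,$$ $$\begin{bmatrix}Q_i&*\\ \Theta_{i,0}(S_1,\dots,S_\tau)Q_i+\sum_{r=1}^{\tau}\Theta_{i,r}(S_1,\dots,S_\tau)Y_{i,r}&Q_j\end{bmatrix}\succ0\qquad\forall i\ne j\in\mathcal{I}_N,\ \forall S_1,\dots,S_\tau\in\mathcal{V}_m,$$ $$\begin{bmatrix}1&Y_{i,t}^{j\bullet}\\ *&Q_i\end{bmatrix}\succeq0\qquad\forall i\in\mathcal{I}_N,\ \forall t\in\{1,\dots,\tau\},\ \forall j\in\{1,\dots,m\}.$$ (In the paper such matrices are selected by maximizing $\sum_{i=1}^N\mathrm{tr}(Q_i)$ subject to these constraints.) Then the origin of the saturated switched system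 is locally asymptotically stable with dwell-time $\tau$, and the set $\Psi=\bigcap_{i\in\mathcal{I}_N}\mathcal{E}(Q_i^{-1})$ is an estimate of the domain of attraction, i.e. it is contained in the domain of attraction of the system with dwell-time $\tau$. Moreover, the auxiliary matrices are obtained as $H_{i,t}=Y_{i,t}P_i$ with $P_i=Q_i^{-1}$; that is, these $P_i$ and $H_{i,t}$ satisfy, with $E_i^t$ as defined in the context (and $E_i=E_i^1$): $E_i(x,S_1)^TP_iE_i(x,S_1)<x^TP_ix$ for all $x\ne0$, $i\in\mathcal{I}_N$, $S_1\in\mathcal{V}_m$; $E_i^\tau(x,S_1,\dots,S_\tau)^TP_jE_i^\tau(x,S_1,\dots,S_\tau)<x^TP_ix$ for all $x\neq0$, $i\neq j\in\mathcal{I}_N$, $S_1,\dots,S_\tau\in\mathcal{V}_m$; and $\mathcal{E}(P_i)\subseteq\mathcal{L}(H_{i,t})$ for all $i\in\mathcal{I}_N$ and $t=1,\dots,\tau$.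
   Context: Here $x\in\mathbb{R}^n$, $A_i\in\mathbb{R}^{n\times n}$, $B_i\in\mathbb{R}^{n\times m}$, $K_i\in\mathbb{R}^{m\times n}$ for $i\in\mathcal{I}_N$, and $\mathbb{Z}^+$ is the set of non-negative integers. The saturation function $\mathrm{sat}:\mathbb{R}^m\to\mathbb{R}^m$ acts componentwise: $\mathrm{sat}(u)_j=\mathrm{sgn}(u_j)\min\{1,|u_j|\}$. Notation: $\mathcal{V}_m$ is the set of all subsets of $\{1,\dots,m\}$ (including the empty set); for $S\in\mathcal{V}_m$, $S^c=\{1,\dots,m\}\setminus S$, and $D_S$ is the $m\times m$ diagonal matrix with $D_S(j,j)=1$ if $j\in S$ and $0$ otherwise. For a matrix $Y$, $Y^{j\bullet}$ is its $j$-th row and $Y^{\bullet j}$ its $j$-th column. $\mathcal{E}(P)=\{x\in\mathbb{R}^n:x^TPx\le1\}$ and $\mathcal{L}(H)=\{x\in\mathbb{R}^n:\|Hx\|_\infty\le1\}$. The functions $E_i^t$: given $H_{i,1},\dots,H_{i,\tau}\in\mathbb{R}^{m\times n}$, put $M_i(S)=A_i+\sum_{j\in S^c}B_i^{\bullet j}K_i^{j\bullet}$ and define $$E_i(x,S_1)=E_i^1(x,S_1)=M_i(S_1)x+B_iD_{S_1}H_{i,1}x,$$ $$E_i^t(x,S_1,\dots,S_t)=M_i(S_t)E_i^{t-1}(x,S_1,\dots,S_{t-1})+B_iD_{S_t}H_{i,t}x\quad(2\le t\le\tau).$$ The matrices $\Theta_{i,r}(S_1,\dots,S_t)$, depending only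 on $A_i,B_i,K_i$ and $S_1,\dots,S_t$, are the coefficients in the affine representation $$E_i^t(x,S_1,\dots,S_t)=\Theta_{i,0}(S_1,\dots,S_t)x+\sum_{r=1}^t\Theta_{i,r}(S_1,\dots,S_t)H_{i,r}x;$$ explicitly, $\Theta_{i,0}(S_1,\dots,S_t)=M_i(S_t)M_i(S_{t-1})\cdots M_i(S_1)$ and $\Theta_{i,r}(S_1,\dots,S_t)=M_i(S_t)\cdots M_i(S_{r+1})B_iD_{S_r}$ for $1\le r\le t$ (the product of the $M_i$'s being the identity when $r=t$). Dwell time: the switching signal $\sigma:\mathbb{Z}^+\to\mathcal{I}_N$ has switching instants $t_0=0<t_1<t_2<\cdots$ (the signal is constant on each $[t_k,t_{k+1})$ and changes value at $t_1,t_2,\dots$). It is dwell-time admissible (DT-admissible) with dwell-time $\tau$ if $t_{k+1}-t_k\ge\tau$ for all $k\in\mathbb{Z}^+$. Local asymptotic stability of the origin with dwell-time $\tau$ means local asymptotic stability under every switching signal that is DT-admissible with dwell-time $\tau$; the domain of attraction is the set of initial states $x(0)$ from which $x(t)\to0$ as $t\to\infty$ under every such switching signal. Standing assumptions: (A1) for every $i\in\mathcal{I}_N$ all eigenvalues of $A_i+B_iK_i$ lie strictly inside the unit disc; (A2) a value of $\tau\ge1$ has been identified for which the unsaturated switched system $x(t+1)=(A_{\sigma(t)}+B_{\sigma(t)}K_{\sigma(t)})x(t)$ is asymptotically stable with dwell-time $\tau$. *)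

theory Defs
  imports "HOL-Analysis.Analysis"
begin

(* Loewner order relative to 0; symmetry is part of the notion. *)
definition pos_def :: "real^'a^'a \<Rightarrow> bool" where
  "pos_def M \<longleftrightarrow> transpose M = M \<and> (\<forall>x. x \<noteq> 0 \<longrightarrow> 0 < x \<bullet> (M *v x))"

definition pos_semidef :: "real^'a^'a \<Rightarrow> bool" where
  "pos_semidef M \<longleftrightarrow> transpose M = M \<and> (\<forall>x. 0 \<le> x \<bullet> (M *v x))"

definition block_matrix ::
  "real^'a^'c \<Rightarrow> real^'b^'c \<Rightarrow> real^'a^'d \<Rightarrow> real^'b^'d \<Rightarrow> real^('a + 'b)^('c + 'd)" where
  "block_matrix M11 M12 M21 M22 =
     (\<chi> p q. case p of
         Inl i \<Rightarrow> (case q of Inl j \<Rightarrow> M11 $ i $ j | Inr j \<Rightarrow> M12 $ i $ j)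
       | Inr i \<Rightarrow> (case q of Inl j \<Rightarrow> M21 $ i $ j | Inr j \<Rightarrow> M22 $ i $ j))"

definition complex_eigenvalue :: "real^'a^'a \<Rightarrow> complex \<Rightarrow> bool" where
  "complex_eigenvalue M z \<longleftrightarrow> (\<exists>v. v \<noteq> 0 \<and> map_matrix complex_of_real M *v v = z *s v)"

definition schur_stable :: "real^'a^'a \<Rightarrow> bool" where
  "schur_stable M \<longleftrightarrow> (\<forall>z. complex_eigenvalue M z \<longrightarrow> cmod z < 1)"

definition diag_ind :: "'m set \<Rightarrow> real^'m^'m" where
  "diag_ind S = (\<chi> i j. if i = j \<and> j \<in> S then 1 else 0)"

definition sat :: "real^'m \<Rightarrow> real^'m" where
  "sat u = (\<chi> j. sgn (u $ j) * min 1 \<bar>u $ j\<bar>)"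

definition ellipsoid :: "real^'n^'n \<Rightarrow> (real^'n) set" where
  "ellipsoid P = {x. x \<bullet> (P *v x) \<le> 1}"

definition lin_region :: "real^'n^'m \<Rightarrow> (real^'n) set" where
  "lin_region H = {x. infnorm (H *v x) \<le> 1}"

(* For a single mode with matrices A, B, K. A tuple (S_1,...,S_t) of subsets of the
   input index set is a sequence S :: nat => 'm set of which only the entries 1..t are read;
   likewise for H_1,...,H_t. *)

definition M_mat :: "real^'n^'n \<Rightarrow> real^'m^'n \<Rightarrow> real^'n^'m \<Rightarrow> 'm set \<Rightarrow> real^'n^'n" where
  "M_mat A B K S =
     A + (\<Sum>j\<in>-S. (columnvector (column j B) :: real^1^'n) ** rowvector (row j K))"

(* E_map ... t is E^t for t >= 1; the value x at t = 0 only starts the recursion. *)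
primrec E_map ::
  "real^'n^'n \<Rightarrow> real^'m^'n \<Rightarrow> real^'n^'m \<Rightarrow> (nat \<Rightarrow> real^'n^'m) \<Rightarrow> (nat \<Rightarrow> 'm set)
     \<Rightarrow> nat \<Rightarrow> real^'n \<Rightarrow> real^'n" where
  "E_map A B K H S 0 x = x"
| "E_map A B K H S (Suc t) x =
     M_mat A B K (S (Suc t)) *v E_map A B K H S t x
     + (B ** diag_ind (S (Suc t)) ** H (Suc t)) *v x"

(* M(S_t) ** ... ** M(S_{r+1}), the identity if r = t *)
definition M_prod ::
  "real^'n^'n \<Rightarrow> real^'m^'n \<Rightarrow> real^'n^'m \<Rightarrow> (nat \<Rightarrow> 'm set) \<Rightarrow> nat \<Rightarrow> nat \<Rightarrow> real^'n^'n" where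
  "M_prod A B K S r t = fold (\<lambda>k P. M_mat A B K (S k) ** P) [Suc r..<Suc t] (mat 1)"

definition Theta0 ::
  "real^'n^'n \<Rightarrow> real^'m^'n \<Rightarrow> real^'n^'m \<Rightarrow> (nat \<Rightarrow> 'm set) \<Rightarrow> nat \<Rightarrow> real^'n^'n" where
  "Theta0 A B K S t = M_prod A B K S 0 t"

definition Theta ::
  "real^'n^'n \<Rightarrow> real^'m^'n \<Rightarrow> real^'n^'m \<Rightarrow> (nat \<Rightarrow> 'm set) \<Rightarrow> nat \<Rightarrow> nat \<Rightarrow> real^'m^'n" where
  "Theta A B K S r t = M_prod A B K S r t ** B ** diag_ind (S r)"

lemma M_prod_self: "M_prod A B K S t t = mat 1"
  by (simp add: M_prod_def)

lemma M_prod_Suc: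
  assumes "r \<le> t"
  shows "M_prod A B K S r (Suc t) = M_mat A B K (S (Suc t)) ** M_prod A B K S r t"
  using assms by (simp add: M_prod_def)

lemma E_map_affine:
  "E_map A B K H S t x =
     Theta0 A B K S t *v x + (\<Sum>r=1..t. Theta A B K S r t *v (H r *v x))"
proof (induction t)
  case 0
  then show ?case by (simp add: Theta0_def M_prod_self)
next
  case (Suc t)
  have "(\<Sum>r=1..t. Theta A B K S r (Suc t) *v (H r *v x)) =
        M_mat A B K (S (Suc t)) *v (\<Sum>r=1..t. Theta A B K S r t *v (H r *v x))"
    unfolding linear_sum[OF matrix_vector_mul_linear]
    by (intro sum.cong)
      (auto simp: Theta_def M_prod_Suc matrix_vector_mul_assoc matrix_mul_assoc)
  then show ?case
    using Suc
    by (simp add: Theta0_def Theta_def M_prod_Suc M_prod_self matrix_vector_right_distrib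
        matrix_vector_mul_assoc matrix_mul_assoc)
qed

definition switching_instants :: "(nat \<Rightarrow> nat) \<Rightarrow> nat set" where
  "switching_instants \<sigma> = insert 0 {t. 0 < t \<and> \<sigma> t \<noteq> \<sigma> (t - 1)}"

(* The set of switching instants may be finite: (eventually) constant signals are
   admissible. Bounding the gap between any two instants is the same as bounding the gap
   between consecutive ones. *)
definition dt_admissible :: "nat \<Rightarrow> nat \<Rightarrow> (nat \<Rightarrow> nat) \<Rightarrow> bool" where
  "dt_admissible N \<tau> \<sigma> \<longleftrightarrow>
     (\<forall>t. \<sigma> t \<in> {1..N}) \<and>
     (\<forall>s\<in>switching_instants \<sigma>. \<forall>t\<in>switching_instants \<sigma>. s < t \<longrightarrow> s + \<tau> \<le> t)"

primrec trajectory ::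
  "(nat \<Rightarrow> 'a \<Rightarrow> 'a) \<Rightarrow> (nat \<Rightarrow> nat) \<Rightarrow> 'a \<Rightarrow> nat \<Rightarrow> 'a" where
  "trajectory f \<sigma> x0 0 = x0"
| "trajectory f \<sigma> x0 (Suc t) = f (\<sigma> t) (trajectory f \<sigma> x0 t)"

definition lyapunov_stable ::
  "(nat \<Rightarrow> 'a::real_normed_vector \<Rightarrow> 'a) \<Rightarrow> (nat \<Rightarrow> nat) \<Rightarrow> bool" where
  "lyapunov_stable f \<sigma> \<longleftrightarrow>
     (\<forall>\<epsilon>>0. \<exists>\<delta>>0. \<forall>x0. norm x0 < \<delta> \<longrightarrow> (\<forall>t. norm (trajectory f \<sigma> x0 t) < \<epsilon>))"

definition locally_asymptotically_stable_dt ::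
  "(nat \<Rightarrow> 'a::real_normed_vector \<Rightarrow> 'a) \<Rightarrow> nat \<Rightarrow> nat \<Rightarrow> bool" where
  "locally_asymptotically_stable_dt f N \<tau> \<longleftrightarrow>
     (\<forall>\<sigma>. dt_admissible N \<tau> \<sigma> \<longrightarrow>
        lyapunov_stable f \<sigma> \<and>
        (\<exists>\<delta>>0. \<forall>x0. norm x0 < \<delta> \<longrightarrow> trajectory f \<sigma> x0 \<longlonglongrightarrow> 0))"

definition asymptotically_stable_dt ::
  "(nat \<Rightarrow> 'a::real_normed_vector \<Rightarrow> 'a) \<Rightarrow> nat \<Rightarrow> nat \<Rightarrow> bool" where
  "asymptotically_stable_dt f N \<tau> \<longleftrightarrow>
     (\<forall>\<sigma>. dt_admissible N \<tau> \<sigma> \<longrightarrow>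
        lyapunov_stable f \<sigma> \<and> (\<forall>x0. trajectory f \<sigma> x0 \<longlonglongrightarrow> 0))"

definition domain_of_attraction_dt ::
  "(nat \<Rightarrow> 'a::real_normed_vector \<Rightarrow> 'a) \<Rightarrow> nat \<Rightarrow> nat \<Rightarrow> 'a set" where
  "domain_of_attraction_dt f N \<tau> =
     {x0. \<forall>\<sigma>. dt_admissible N \<tau> \<sigma> \<longrightarrow> trajectory f \<sigma> x0 \<longlonglongrightarrow> 0}"

definition saturated_system ::
  "(nat \<Rightarrow> real^'n^'n) \<Rightarrow> (nat \<Rightarrow> real^'m^'n) \<Rightarrow> (nat \<Rightarrow> real^'n^'m) \<Rightarrow> nat \<Rightarrow> real^'n \<Rightarrow> real^'n" where
  "saturated_system A B K i x = A i *v x + B i *v sat (K i *v x)"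

definition unsaturated_system ::
  "(nat \<Rightarrow> real^'n^'n) \<Rightarrow> (nat \<Rightarrow> real^'m^'n) \<Rightarrow> (nat \<Rightarrow> real^'n^'m) \<Rightarrow> nat \<Rightarrow> real^'n \<Rightarrow> real^'n" where
  "unsaturated_system A B K i x = (A i + B i ** K i) *v x"

end

theory Submission
  imports Defs
begin

text \<open>The functions \<open>V\<^sub>i x = x \<bullet> P\<^sub>i x\<close> with \<open>P\<^sub>i = Q\<^sub>i\<^sup>-\<^sup>1\<close> form a family of
  Lyapunov functions that decrease in two situations: by a factor at every step of a fixed mode,
  and by a factor over the last \<open>\<tau>\<close> steps before a switch, when the function is exchanged as well.
  At the steps of that last stretch nothing is claimed about the function of the next mode.

  The saturated map is nonlinear, and the matrix inequalities are linear. The link is the following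
  observation: if \<open>\<bar>h\<^sub>j\<bar> \<le> 1\<close>, then \<open>sat(u)\<^sub>j\<close> lies between \<open>u\<^sub>j\<close> and \<open>h\<^sub>j\<close>, so \<open>sat(u)\<close> is a convex
  combination of the \<open>2\<^sup>m\<close> vectors that mix the coordinates of \<open>u\<close> and \<open>h\<close>. On the ellipsoid of \<open>P\<^sub>i\<close>
  the vectors \<open>H\<^sub>i\<^sub>,\<^sub>t x\<close> may serve as \<open>h\<close>, because the third family of inequalities bounds their
  coordinates by 1. Taking at the \<open>r\<close>-th step the vector \<open>H\<^sub>i\<^sub>,\<^sub>r x\<close> with the initial state \<open>x\<close> (and not
  the current one), the \<open>t\<close>-step image of \<open>x\<close> is in the convex hull of the points
  \<open>E\<^sub>i\<^sup>t(x, S\<^sub>1, \<dots>, S\<^sub>t)\<close> (\<open>saturated_iterate_in_convex_hull\<close>). These depend linearly on \<open>x\<close>, and the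
  first two families of inequalities say exactly that \<open>V\<^sub>j\<close> at such a point is below \<open>V\<^sub>i x\<close>
  (\<open>Theta_LMI_imp_E_map_less\<close>). Sublevel sets of \<open>V\<^sub>j\<close> are convex, so the image of \<open>x\<close> inherits the
  bound. Compactness of the sphere and finiteness of the choices give one factor \<open>\<rho> < 1\<close> for all.

  With \<open>r = \<rho>\<^sup>1\<^sup>/\<^sup>\<tau>\<close> both kinds of decrease amount to a contraction by at least \<open>r\<close> per unit of time, whence
  \<open>V\<^bsub>\<sigma>(t)\<^esub>(x(t)) \<le> r\<^sup>t V\<^bsub>\<sigma>(0)\<^esub>(x(0))\<close> (\<open>multiple_lyapunov_decay\<close>). The bound keeps the state inside
  the ellipsoids, which is where the convex hull argument applies, and it yields both attraction
  and stability (\<open>dwell_time_stability\<close>).\<close>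

section \<open>Block matrix inequalities\<close>

abbreviation (input) quad_form :: "real^'a^'a \<Rightarrow> real^'a \<Rightarrow> real" where
  "quad_form P x \<equiv> x \<bullet> (P *v x)"

definition join_vec :: "real^'a \<Rightarrow> real^'b \<Rightarrow> real^('a + 'b)" where
  "join_vec v w = (\<chi> p. case p of Inl i \<Rightarrow> v $ i | Inr j \<Rightarrow> w $ j)"

lemma sum_UNIV_Plus:
  fixes g :: "'a::finite + 'b::finite \<Rightarrow> real"
  shows "sum g UNIV = (\<Sum>i\<in>UNIV. g (Inl i)) + (\<Sum>j\<in>UNIV. g (Inr j))"
  using sum.Plus[of "UNIV :: 'a set" "UNIV :: 'b set" g] by simp

lemma quad_form_block_matrix:
  "quad_form (block_matrix M11 M12 M21 M22) (join_vec v w) =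
     quad_form M11 v + v \<bullet> (M12 *v w) + w \<bullet> (M21 *v v) + quad_form M22 w"
  by (simp add: inner_vec_def matrix_vector_mult_def block_matrix_def join_vec_def
      sum_UNIV_Plus sum.distrib distrib_left)

lemma join_vec_nonzero: "v \<noteq> 0 \<Longrightarrow> join_vec v w \<noteq> 0"
proof
  assume v: "v \<noteq> 0" and "join_vec v w = 0"
  then have "v $ i = 0" for i
    by (metis join_vec_def sum.case(1) vec_lambda_beta zero_index)
  with v show False by (simp add: vec_eq_iff)
qed

lemma pos_def_invertible:
  assumes "pos_def Q"
  shows "invertible Q"
proof -
  have "x = 0" if "Q *v x = 0" for x
    using assms that unfolding pos_def_def by (metis inner_zero_right less_irrefl)
  then show ?thesis
    by (metis invertible_left_inverse matrix_left_invertible_ker)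
qed

lemma matrix_inv_inverse:
  assumes "invertible M"
  shows "M ** matrix_inv M = mat 1" "matrix_inv M ** M = mat 1"
  using someI_ex[OF assms[unfolded invertible_def]] by (simp_all add: matrix_inv_def)

lemma matrix_inv_vector_cancel:
  fixes Q :: "real^'a^'a"
  assumes "pos_def Q"
  shows "Q *v (matrix_inv Q *v x) = x" "matrix_inv Q *v (Q *v x) = x"
  using matrix_inv_inverse[OF pos_def_invertible[OF assms]]
  by (simp_all add: matrix_vector_mul_assoc)

lemma pos_def_matrix_inv:
  assumes "pos_def Q"
  shows "pos_def (matrix_inv Q)"
proof -
  have inv: "invertible Q" and sym: "transpose Q = Q"
    using assms pos_def_invertible by (auto simp: pos_def_def)
  have "transpose (matrix_inv Q) ** Q = mat 1"
    using matrix_transpose_mul[of Q "matrix_inv Q"] by (simp add: sym matrix_inv_inverse[OF inv] transpose_mat)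
  then have "transpose (matrix_inv Q) ** (Q ** matrix_inv Q) = matrix_inv Q"
    by (simp add: matrix_mul_assoc)
  then have "transpose (matrix_inv Q) = matrix_inv Q"
    by (simp add: matrix_inv_inverse[OF inv])
  moreover have "0 < quad_form (matrix_inv Q) x" if "x \<noteq> 0" for x
  proof -
    have "matrix_inv Q *v x \<noteq> 0"
      using that matrix_inv_vector_cancel(1)[OF assms, of x] by (metis matrix_vector_mult_0_right)
    then have "0 < quad_form Q (matrix_inv Q *v x)"
      using assms by (simp add: pos_def_def)
    then show ?thesis
      by (simp add: matrix_inv_vector_cancel[OF assms] inner_commute)
  qed
  ultimately show ?thesis by (simp add: pos_def_def)
qed

text \<open>The half of the Schur complement criterion that extracts information from a block inequality.
  Testing the block form with \<open>(v, w) = (Q1\<^sup>-\<^sup>1 x, - Q2\<^sup>-\<^sup>1 L x)\<close>, which for the given \<open>v\<close> minimises it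
  over \<open>w\<close>, leaves the difference of the two quadratic forms.\<close>
lemma block_pos_def_imp_quad_form_less:
  fixes Q1 :: "real^'a^'a" and Q2 :: "real^'b^'b" and L :: "real^'a^'b"
  assumes Q1: "pos_def Q1" and Q2: "pos_def Q2"
    and block: "pos_def (block_matrix Q1 (transpose (L ** Q1)) (L ** Q1) Q2)"
    and x: "x \<noteq> 0"
  shows "quad_form (matrix_inv Q2) (L *v x) < quad_form (matrix_inv Q1) x"
proof -
  define v where "v = matrix_inv Q1 *v x"
  define w where "w = - (matrix_inv Q2 *v (L *v x))"
  have v: "Q1 *v v = x" by (simp add: v_def matrix_inv_vector_cancel[OF Q1])
  then have "v \<noteq> 0" using x by (metis matrix_vector_mult_0_right)
  then have pos: "0 < quad_form (block_matrix Q1 (transpose (L ** Q1)) (L ** Q1) Q2) (join_vec v w)"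
    using block join_vec_nonzero by (auto simp: pos_def_def)
  have Xv: "(L ** Q1) *v v = L *v x"
    by (simp add: matrix_vector_mul_assoc[symmetric] v)
  have "v \<bullet> (transpose (L ** Q1) *v w) = w \<bullet> (L *v x)"
    by (metis Xv dot_lmul_matrix inner_commute transpose_matrix_vector)
  moreover have "quad_form Q2 w = - (w \<bullet> (L *v x))"
  proof -
    have "Q2 *v w = - (L *v x)"
      using matrix_inv_vector_cancel(1)[OF Q2, of "L *v x"]
      by (metis w_def linear_neg matrix_vector_mul_linear)
    then show ?thesis by simp
  qed
  moreover have "w \<bullet> (L *v x) = - quad_form (matrix_inv Q2) (L *v x)"
    by (simp add: w_def inner_commute)
  moreover have "quad_form Q1 v = quad_form (matrix_inv Q1) x"
    by (simp add: v) (simp add: v_def inner_commute)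
  ultimately show ?thesis
    using pos unfolding quad_form_block_matrix Xv by simp
qed

text \<open>Here the test vector is \<open>(- y w, w)\<close> with \<open>w = Q\<^sup>-\<^sup>1 x\<close>: the scalar component is again the
  minimiser of the block form for fixed \<open>w\<close>.\<close>
lemma row_block_pos_semidef_imp_square_le:
  fixes Q :: "real^'a^'a" and y :: "real^'a^1"
  assumes Q: "pos_def Q" and block: "pos_semidef (block_matrix (mat 1) y (transpose y) Q)"
  shows "((y *v (matrix_inv Q *v x)) $ 1)\<^sup>2 \<le> quad_form (matrix_inv Q) x"
proof -
  define w where "w = matrix_inv Q *v x"
  define v :: "real^1" where "v = - (y *v w)"
  have "0 \<le> quad_form (block_matrix (mat 1) y (transpose y) Q) (join_vec v w)"
    using block by (simp add: pos_semidef_def)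
  moreover have "w \<bullet> (transpose y *v v) = v \<bullet> (y *v w)"
    by (metis dot_lmul_matrix inner_commute transpose_matrix_vector)
  moreover have "quad_form Q w = quad_form (matrix_inv Q) x"
    by (simp add: w_def matrix_inv_vector_cancel[OF Q] inner_commute)
  ultimately have "(y *v w) \<bullet> (y *v w) \<le> quad_form (matrix_inv Q) x"
    unfolding quad_form_block_matrix by (simp add: v_def)
  then show ?thesis
    by (simp add: w_def inner_vec_def power2_eq_square)
qed

lemma in_lin_region_iff: "x \<in> lin_region H \<longleftrightarrow> (\<forall>j. \<bar>(H *v x) $ j\<bar> \<le> 1)"
proof -
  have "infnorm y \<le> 1 \<longleftrightarrow> (\<forall>j. \<bar>y $ j\<bar> \<le> 1)" for y :: "real^'m"
    by (auto simp: infnorm_Max Basis_vec_def inner_axis)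
  then show ?thesis by (simp add: lin_region_def)
qed

lemma sum_matrix_vector_mult:
  "(\<Sum>k\<in>I. M k) *v x = (\<Sum>k\<in>I. (M k :: real^'a^'b) *v x)"
  by (induction I rule: infinite_finite_induct) (simp_all add: matrix_vector_mult_add_rdistrib)

lemma E_map_eq_matrix:
  "E_map A B K H S t x =
     (Theta0 A B K S t + (\<Sum>r=1..t. Theta A B K S r t ** H r)) *v x"
proof -
  have "(\<Sum>r=1..t. Theta A B K S r t ** H r) *v x = (\<Sum>r=1..t. (Theta A B K S r t ** H r) *v x)"
    by (rule sum_matrix_vector_mult)
  then show ?thesis
    by (simp add: E_map_affine matrix_vector_mult_add_rdistrib matrix_vector_mul_assoc)
qed

lemma E_map_linear: "linear (E_map A B K H S t)"
  unfolding E_map_eq_matrix[abs_def] by (rule matrix_vector_mul_linear)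

lemma matrix_add_mult_distrib:
  "(M + M') ** N = M ** N + M' ** (N :: real^'c^'a)" for M M' :: "real^'a^'b"
  by (simp add: matrix_matrix_mult_def vec_eq_iff distrib_right sum.distrib)

lemma sum_matrix_mult:
  "(\<Sum>k\<in>I. M k) ** N = (\<Sum>k\<in>I. (M k :: real^'a^'b) ** (N :: real^'c^'a))"
  by (induction I rule: infinite_finite_induct) (simp_all add: matrix_add_mult_distrib)

text \<open>The change of variables \<open>H\<^sub>r = Y\<^sub>r Q1\<^sup>-\<^sup>1\<close> makes the off-diagonal block the product of the matrix
  of \<open>x \<mapsto> E\<^sup>t x\<close> with \<open>Q1\<close>, which is the shape that the block criterion needs.\<close>
lemma Theta_LMI_imp_E_map_less:
  assumes Q1: "pos_def Q1" and Q2: "pos_def Q2"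
    and X: "X = Theta0 A B K S t ** Q1 + (\<Sum>r=1..t. Theta A B K S r t ** Y r)"
    and block: "pos_def (block_matrix Q1 (transpose X) X Q2)" and x: "x \<noteq> 0"
  shows "quad_form (matrix_inv Q2) (E_map A B K (\<lambda>r. Y r ** matrix_inv Q1) S t x)
         < quad_form (matrix_inv Q1) x"
proof -
  define L where "L = Theta0 A B K S t + (\<Sum>r=1..t. Theta A B K S r t ** (Y r ** matrix_inv Q1))"
  have "(\<Sum>r=1..t. Theta A B K S r t ** (Y r ** matrix_inv Q1)) ** Q1
      = (\<Sum>r=1..t. Theta A B K S r t ** Y r)"
    using matrix_inv_inverse(2)[OF pos_def_invertible[OF Q1]]
    by (simp add: sum_matrix_mult matrix_mul_assoc[symmetric])
  then have "L ** Q1 = X" by (simp add: L_def X matrix_add_mult_distrib)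
  then show ?thesis
    using block_pos_def_imp_quad_form_less[OF Q1 Q2, of L x] block x
    unfolding E_map_eq_matrix L_def by simp
qed

lemma row_LMI_imp_ellipsoid_subset:
  assumes Q: "pos_def Q"
    and block: "\<And>j. pos_semidef (block_matrix (mat 1) (rowvector (row j Y) :: real^'n^1)
                  (transpose (rowvector (row j Y))) Q)"
  shows "ellipsoid (matrix_inv Q) \<subseteq> lin_region (Y ** matrix_inv Q)"
proof
  fix x assume x: "x \<in> ellipsoid (matrix_inv Q)"
  have "\<bar>((Y ** matrix_inv Q) *v x) $ j\<bar> \<le> 1" for j
  proof -
    have "((rowvector (row j Y) :: real^'n^1) *v z) $ 1 = (Y *v z) $ j" for z
      by (simp add: matrix_vector_mult_def rowvector_def row_def)
    then have "(((Y ** matrix_inv Q) *v x) $ j)\<^sup>2 \<le> 1"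
      using row_block_pos_semidef_imp_square_le[OF Q block[of j], of x] x
      by (simp add: ellipsoid_def matrix_vector_mul_assoc[symmetric])
    then show ?thesis by (simp add: abs_square_le_1)
  qed
  then show "x \<in> lin_region (Y ** matrix_inv Q)" by (simp add: in_lin_region_iff)
qed

section \<open>Saturation and convex hulls\<close>

definition merge_vec :: "'m set \<Rightarrow> real^'m \<Rightarrow> real^'m \<Rightarrow> real^'m" where
  "merge_vec S v u = (\<chi> j. if j \<in> S then v $ j else u $ j)"

text \<open>A box is the hull of its vertices. The induction replaces the coordinates of a vertex by those
  of \<open>w\<close> one at a time: changing coordinate \<open>k\<close> is a convex combination of the two choices for \<open>k\<close>.\<close>
lemma in_convex_hull_merge_vec:
  assumes "\<And>j. w $ j \<in> closed_segment (u $ j) (v $ j)"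
  shows "w \<in> convex hull (range (\<lambda>S. merge_vec S v u))"
proof -
  let ?C = "convex hull (range (\<lambda>S. merge_vec S v u))"
  have "merge_vec T w (merge_vec S v u) \<in> ?C" if "finite T" for T S
    using that
  proof (induction T arbitrary: S rule: finite_induct)
    case empty
    have "merge_vec {} w (merge_vec S v u) = merge_vec S v u"
      by (simp add: merge_vec_def)
    then show ?case by (simp add: hull_inc)
  next
    case (insert k T)
    obtain a where a: "0 \<le> a" "a \<le> 1" "w $ k = (1 - a) * u $ k + a * v $ k"
      using assms[of k] by (auto simp: closed_segment_def)
    have "merge_vec (insert k T) w (merge_vec S v u) =
        (1 - a) *\<^sub>R merge_vec T w (merge_vec (S - {k}) v u)
        + a *\<^sub>R merge_vec T w (merge_vec (insert k S) v u)"
      using insert.hyps a(3) by (auto simp: merge_vec_def vec_eq_iff algebra_simps)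
    also have "\<dots> \<in> ?C"
      using a insert.IH by (intro convexD[OF convex_convex_hull]) auto
    finally show ?case .
  qed
  from this[of UNIV] show ?thesis by (simp add: merge_vec_def)
qed

text \<open>Either \<open>u\<^sub>j\<close> is not saturated and equals \<open>sat(u)\<^sub>j\<close>, or \<open>sat(u)\<^sub>j = \<plusminus>1\<close> separates \<open>u\<^sub>j\<close> from the
  interval \<open>[-1, 1]\<close> that contains \<open>v\<^sub>j\<close>.\<close>
lemma sat_in_segment:
  assumes "\<bar>v $ j\<bar> \<le> 1"
  shows "sat u $ j \<in> closed_segment (u $ j) (v $ j)"
  using assms
  by (auto simp: sat_def closed_segment_eq_real_ivl sgn_if min_def abs_if split: if_splits)

lemma M_mat_mult:
  "M_mat A B K S *v y = A *v y + B *v merge_vec S 0 (K *v y)"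
proof -
  have "((\<Sum>j\<in>-S. (columnvector (column j B) :: real^1^'a) ** rowvector (row j K)) *v y) $ i
      = (B *v merge_vec S 0 (K *v y)) $ i" for i
  proof -
    have "((\<Sum>j\<in>-S. (columnvector (column j B) :: real^1^'a) ** rowvector (row j K)) *v y) $ i
        = (\<Sum>j\<in>-S. B $ i $ j * (K *v y) $ j)"
      unfolding sum_matrix_vector_mult matrix_vector_mul_assoc[symmetric]
      by (simp add: matrix_vector_mult_def columnvector_def rowvector_def column_def row_def)
    also have "\<dots> = (\<Sum>j\<in>UNIV. B $ i $ j * merge_vec S 0 (K *v y) $ j)"
      by (rule sum.mono_neutral_cong_left) (auto simp: merge_vec_def)
    finally show ?thesis by (simp add: matrix_vector_mult_def)
  qed
  then show ?thesis
    by (simp add: M_mat_def matrix_vector_mult_add_rdistrib vec_eq_iff)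
qed

text \<open>This identity ties the recursion for \<open>E\<close> to the saturated system: both apply \<open>B\<close> to an input
  vector, and the inputs \<open>merge_vec S (G x) (K y)\<close> are the vertices of a box around \<open>sat (K y)\<close>
  whenever the coordinates of \<open>G x\<close> are bounded by 1.\<close>
lemma E_map_step:
  "M_mat A B K S *v y + (B ** diag_ind S ** G) *v x = A *v y + B *v merge_vec S (G *v x) (K *v y)"
proof -
  have "diag_ind S *v z = merge_vec S z 0" for z :: "real^'b"
  proof -
    have "(\<Sum>k\<in>UNIV. (if i = k \<and> k \<in> S then 1 else 0) * z $ k)
        = (\<Sum>k\<in>UNIV. if i = k then (if k \<in> S then z $ k else 0) else 0)" for i
      by (rule sum.cong) auto
    then show ?thesis
      by (simp add: diag_ind_def merge_vec_def matrix_vector_mult_def vec_eq_iff)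
  qed
  moreover have "merge_vec S 0 (K *v y) + merge_vec S z 0 = merge_vec S z (K *v y)" for z
    by (simp add: merge_vec_def vec_eq_iff)
  ultimately show ?thesis
    by (simp add: M_mat_mult matrix_vector_mul_assoc[symmetric] add.assoc
        matrix_vector_right_distrib[symmetric])
qed

lemma linear_plus_const_in_convex_hull:
  assumes "linear L" "y \<in> convex hull R"
  shows "L y + c \<in> convex hull ((\<lambda>z. L z + c) ` R)"
proof -
  have "c + L y \<in> (+) c ` (convex hull (L ` R))"
    using in_convex_hull_linear_image[OF assms] by (rule imageI)
  also have "(+) c ` (convex hull (L ` R)) = convex hull ((\<lambda>z. L z + c) ` R)"
    unfolding convex_hull_translation[symmetric] image_image by (simp only: add.commute)
  finally show ?thesis by (simp only: add.commute)
qed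

lemma E_map_cong:
  "(\<And>k. k \<in> {1..t} \<Longrightarrow> S k = S' k) \<Longrightarrow> E_map A B K H S t x = E_map A B K H S' t x"
  by (induction t) auto

lemma saturated_step_in_convex_hull:
  assumes "\<And>j. \<bar>h $ j\<bar> \<le> 1"
  shows "A *v y + B *v sat (K *v y) \<in> convex hull (range (\<lambda>S. A *v y + B *v merge_vec S h (K *v y)))"
proof -
  have "sat (K *v y) \<in> convex hull (range (\<lambda>S. merge_vec S h (K *v y)))"
    by (intro in_convex_hull_merge_vec sat_in_segment assms)
  from linear_plus_const_in_convex_hull[OF matrix_vector_mul_linear[of B] this, of "A *v y"]
  show ?thesis by (simp add: image_image add.commute)
qed

text \<open>By induction on the number of steps: for each fixed \<open>S\<close> the next step is affine in the current
  state, so it maps the hull of the points reached so far into the hull of the next ones, and the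
  saturated step is a convex combination of these affine steps. The vector \<open>H\<^sub>r x\<close> is the same for
  all points of the hull because it is formed from the initial state; this keeps the map affine.\<close>
lemma saturated_iterate_in_convex_hull:
  assumes "\<And>r j. r \<in> {1..t} \<Longrightarrow> \<bar>(H r *v x) $ j\<bar> \<le> 1"
  shows "((\<lambda>y. A *v y + B *v sat (K *v y)) ^^ t) x \<in> convex hull (range (\<lambda>S. E_map A B K H S t x))"
  using assms
proof (induction t)
  case 0
  then show ?case by simp
next
  case (Suc t)
  define y where "y = ((\<lambda>y. A *v y + B *v sat (K *v y)) ^^ t) x"
  have y: "y \<in> convex hull (range (\<lambda>S. E_map A B K H S t x))"
    unfolding y_def using Suc by simp
  let ?C = "convex hull (range (\<lambda>S. E_map A B K H S (Suc t) x))"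
  have "A *v y + B *v merge_vec S (H (Suc t) *v x) (K *v y) \<in> ?C" for S
  proof -
    let ?g = "\<lambda>z. M_mat A B K S *v z + (B ** diag_ind S ** H (Suc t)) *v x"
    have "?g (E_map A B K H S' t x) = E_map A B K H (S'(Suc t := S)) (Suc t) x" for S'
      using E_map_cong[of t S' "S'(Suc t := S)" A B K H x] by simp
    then have "?g ` range (\<lambda>S. E_map A B K H S t x) \<subseteq> range (\<lambda>S. E_map A B K H S (Suc t) x)"
      by blast
    then have "?g y \<in> ?C"
      using linear_plus_const_in_convex_hull[OF matrix_vector_mul_linear y] hull_mono by blast
    then show ?thesis by (simp only: E_map_step)
  qed
  then have "convex hull (range (\<lambda>S. A *v y + B *v merge_vec S (H (Suc t) *v x) (K *v y))) \<subseteq> ?C"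
    by (intro hull_minimal) (auto simp: convex_convex_hull)
  moreover have "A *v y + B *v sat (K *v y)
      \<in> convex hull (range (\<lambda>S. A *v y + B *v merge_vec S (H (Suc t) *v x) (K *v y)))"
    using Suc.prems by (intro saturated_step_in_convex_hull) simp
  ultimately show ?case by (auto simp: y_def)
qed

section \<open>Uniform contraction\<close>

lemma pos_def_quad_form_nonneg: "pos_def P \<Longrightarrow> 0 \<le> quad_form P x"
  unfolding pos_def_def by (metis inner_zero_left less_imp_le order_refl)

lemma quad_form_scaleR: "quad_form P (a *\<^sub>R x) = a\<^sup>2 * quad_form P x"
  by (simp add: matrix_vector_mult_scaleR power2_eq_square)

lemma convex_quad_form_sublevel:
  assumes "pos_def P"
  shows "convex {x. quad_form P x \<le> c}"
proof (rule convexI)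
  fix x y and u v :: real
  assume xy: "x \<in> {x. quad_form P x \<le> c}" "y \<in> {x. quad_form P x \<le> c}"
    and uv: "0 \<le> u" "0 \<le> v" "u + v = 1"
  have sym: "x \<bullet> (P *v y) = y \<bullet> (P *v x)"
    using assms by (metis dot_lmul_matrix inner_commute pos_def_def transpose_matrix_vector)
  have nonneg: "0 \<le> quad_form P (x - y)"
    using assms by (rule pos_def_quad_form_nonneg)
  have v: "v = 1 - u" using uv by simp
  \<comment> \<open>The defect of convexity of a quadratic form is a multiple of its value at the difference.\<close>
  have "quad_form P (u *\<^sub>R x + v *\<^sub>R y)
      = u * quad_form P x + v * quad_form P y - u * v * quad_form P (x - y)"
    by (simp add: v matrix_vector_right_distrib matrix_vector_mult_diff_distrib
        matrix_vector_mult_scaleR inner_add_left inner_add_right inner_diff_left inner_diff_right sym)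
      (simp add: algebra_simps)
  also have "\<dots> \<le> u * c + v * c"
  proof -
    have "u * quad_form P x \<le> u * c" "v * quad_form P y \<le> v * c"
      "0 \<le> u * v * quad_form P (x - y)"
      using xy uv nonneg by (auto intro: mult_left_mono)
    then show ?thesis by linarith
  qed
  also have "\<dots> = c" using uv by (metis distrib_right mult_1)
  finally show "u *\<^sub>R x + v *\<^sub>R y \<in> {x. quad_form P x \<le> c}" by simp
qed

text \<open>The constant is the minimum of \<open>f\<close> on the unit sphere.\<close>
lemma pos_homogeneous_lower_bound:
  fixes f :: "real^'a \<Rightarrow> real"
  assumes cont: "continuous_on UNIV f" and hom: "\<And>a x. f (a *\<^sub>R x) = a\<^sup>2 * f x"
    and pos: "\<And>x. x \<noteq> 0 \<Longrightarrow> 0 < f x"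
  shows "\<exists>c>0. \<forall>x. c * (norm x)\<^sup>2 \<le> f x"
proof -
  have "\<exists>x\<in>sphere 0 1. \<forall>y\<in>sphere 0 1. f x \<le> f y"
    by (rule continuous_attains_inf) (auto intro: continuous_on_subset[OF cont])
  then obtain z where z: "norm z = 1" "\<And>y. norm y = 1 \<Longrightarrow> f z \<le> f y"
    by auto
  have "f z * (norm x)\<^sup>2 \<le> f x" for x
  proof (cases "x = 0")
    case True
    then show ?thesis using hom[of 0 0] by simp
  next
    case False
    have "f x = (norm x)\<^sup>2 * f (sgn x)"
      using hom[of "norm x" "sgn x"] False by (simp add: sgn_div_norm)
    moreover have "f z \<le> f (sgn x)"
      using z(2) False by (simp add: norm_sgn)
    ultimately show ?thesis by (simp add: mult.commute mult_right_mono)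
  qed
  moreover have "0 < f z" using pos[of z] z(1) by force
  ultimately show ?thesis by blast
qed

lemma continuous_on_quad_form: "continuous_on UNIV (quad_form P)"
  by (intro continuous_on_inner continuous_on_id matrix_vector_mult_linear_continuous_on)

lemma quad_form_lower_bound:
  assumes "pos_def P"
  shows "\<exists>c>0. \<forall>x. c * (norm x)\<^sup>2 \<le> quad_form P x"
  using assms
  by (intro pos_homogeneous_lower_bound continuous_on_quad_form quad_form_scaleR)
    (simp add: pos_def_def)

lemma quad_form_upper_bound: "\<exists>C>0. \<forall>x. quad_form P x \<le> C * (norm x)\<^sup>2"
proof -
  obtain C where C: "C > 0" "\<And>x. norm (P *v x) \<le> C * norm x"
    using linear_bounded_pos[OF matrix_vector_mul_linear[of P]] by blast
  have "quad_form P x \<le> C * (norm x)\<^sup>2" for x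
  proof -
    have "quad_form P x \<le> norm x * norm (P *v x)" by (rule norm_cauchy_schwarz)
    also have "\<dots> \<le> norm x * (C * norm x)" by (intro mult_left_mono C) simp
    finally show ?thesis by (simp add: power2_eq_square mult_ac)
  qed
  then show ?thesis using C(1) by blast
qed

text \<open>A strict pointwise inequality between quadratic forms has a gap of at least \<open>d \<bar>x\<bar>\<^sup>2\<close>, and
  \<open>\<bar>x\<bar>\<^sup>2\<close> is at least a multiple of the larger form, so the gap is at least a fixed fraction of it.\<close>
lemma strict_decrease_imp_contraction:
  assumes L: "linear L" and less: "\<And>x. x \<noteq> 0 \<Longrightarrow> quad_form P2 (L x) < quad_form P1 x"
  shows "\<exists>\<rho><1. \<forall>x. quad_form P2 (L x) \<le> \<rho> * quad_form P1 x"
proof -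
  let ?f = "\<lambda>x. quad_form P1 x - quad_form P2 (L x)"
  have "\<exists>d>0. \<forall>x. d * (norm x)\<^sup>2 \<le> ?f x"
  proof (rule pos_homogeneous_lower_bound)
    show "continuous_on UNIV ?f"
      using L continuous_on_compose2[OF continuous_on_quad_form[of P2], of UNIV L]
      by (intro continuous_on_diff continuous_on_quad_form)
        (simp add: linear_continuous_on linear_conv_bounded_linear)
    show "?f (a *\<^sub>R x) = a\<^sup>2 * ?f x" for a x
      by (simp only: linear_cmul[OF L] quad_form_scaleR right_diff_distrib)
  qed (simp add: less)
  then obtain d where d: "d > 0" "\<And>x. d * (norm x)\<^sup>2 \<le> ?f x" by blast
  obtain C where C: "C > 0" "\<And>x. quad_form P1 x \<le> C * (norm x)\<^sup>2"
    using quad_form_upper_bound by blast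
  have "quad_form P2 (L x) \<le> (1 - d / C) * quad_form P1 x" for x
  proof -
    have "d / C * quad_form P1 x \<le> d / C * (C * (norm x)\<^sup>2)"
      using C d by (intro mult_left_mono) auto
    also have "\<dots> = d * (norm x)\<^sup>2" using C by simp
    finally show ?thesis using d(2)[of x] by (simp add: algebra_simps)
  qed
  moreover have "1 - d / C < 1" using C d by simp
  ultimately show ?thesis by blast
qed

text \<open>The common factor is positive so that a root of it can serve as a rate of decay.\<close>
lemma uniform_contraction_factor:
  fixes f g :: "'i \<Rightarrow> 'x \<Rightarrow> real"
  assumes "finite I" "\<And>k. k \<in> I \<Longrightarrow> \<exists>\<rho><1. \<forall>x\<in>X k. f k x \<le> \<rho> * g k x"
    and nonneg: "\<And>k x. k \<in> I \<Longrightarrow> 0 \<le> g k x"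
  shows "\<exists>\<rho>. 0 < \<rho> \<and> \<rho> < 1 \<and> (\<forall>k\<in>I. \<forall>x\<in>X k. f k x \<le> \<rho> * g k x)"
proof -
  obtain R where R: "\<And>k. k \<in> I \<Longrightarrow> R k < 1"
      "\<And>k x. k \<in> I \<Longrightarrow> x \<in> X k \<Longrightarrow> f k x \<le> R k * g k x"
    using assms(2) by metis
  \<comment> \<open>The value 1/2 makes the maximum positive and covers an empty index set.\<close>
  define \<rho> where "\<rho> = Max (insert (1/2) (R ` I))"
  have fin: "finite (insert (1/2) (R ` I))" using assms(1) by simp
  have "\<rho> < 1" unfolding \<rho>_def using fin R(1) by (subst Max_less_iff) auto
  moreover have "0 < \<rho>" unfolding \<rho>_def using fin by (subst Max_gr_iff) auto
  moreover have "f k x \<le> \<rho> * g k x" if "k \<in> I" "x \<in> X k" for k x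
  proof -
    have "R k \<le> \<rho>" unfolding \<rho>_def using fin that by (intro Max_ge) auto
    then show ?thesis
      using R(2)[OF that] mult_right_mono[OF _ nonneg[OF that(1), of x]] by fastforce
  qed
  ultimately show ?thesis by blast
qed

text \<open>There are infinitely many sequences \<open>S\<close>, but only the entries \<open>1..t\<close> matter. Normalising the others
  to the empty set leaves finitely many.\<close>
lemma E_map_uniform_contraction:
  assumes "pos_def P1" and less: "\<And>S x. x \<noteq> 0 \<Longrightarrow> quad_form P2 (E_map A B K H S t x) < quad_form P1 x"
  shows "\<exists>\<rho><1. \<forall>S x. quad_form P2 (E_map A B K H S t x) \<le> \<rho> * quad_form P1 x"
proof -
  let ?T = "{S :: nat \<Rightarrow> 'b set. \<forall>k. (k \<in> {1..t} \<longrightarrow> S k \<in> UNIV) \<and> (k \<notin> {1..t} \<longrightarrow> S k = {})}"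
  have "finite ?T" by (rule finite_set_of_finite_funs) auto
  then have "\<exists>\<rho>. 0 < \<rho> \<and> \<rho> < 1
      \<and> (\<forall>S\<in>?T. \<forall>x\<in>UNIV. quad_form P2 (E_map A B K H S t x) \<le> \<rho> * quad_form P1 x)"
    using strict_decrease_imp_contraction[OF E_map_linear less] pos_def_quad_form_nonneg[OF assms(1)]
    by (intro uniform_contraction_factor) simp_all
  then obtain \<rho> where \<rho>: "\<rho> < 1"
      "\<And>S x. S \<in> ?T \<Longrightarrow> quad_form P2 (E_map A B K H S t x) \<le> \<rho> * quad_form P1 x"
    by blast
  have "quad_form P2 (E_map A B K H S t x) \<le> \<rho> * quad_form P1 x" for S x
  proof -
    define S' where "S' k = (if k \<in> {1..t} then S k else {})" for k
    have "E_map A B K H S t x = E_map A B K H S' t x"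
      by (rule E_map_cong) (simp add: S'_def)
    then show ?thesis using \<rho>(2)[of S'] by (simp add: S'_def)
  qed
  with \<rho>(1) show ?thesis by blast
qed

text \<open>A bound on \<open>x \<bullet> P2 x\<close> at the points \<open>E\<^sup>t\<close> extends to their convex hull, since sublevel sets are
  convex.\<close>
lemma saturated_iterate_contraction:
  assumes P1: "pos_def P1" and P2: "pos_def P2"
    and less: "\<And>S x. x \<noteq> 0 \<Longrightarrow> quad_form P2 (E_map A B K H S t x) < quad_form P1 x"
    and region: "\<And>r. r \<in> {1..t} \<Longrightarrow> ellipsoid P1 \<subseteq> lin_region (H r)"
  shows "\<exists>\<rho><1. \<forall>x\<in>ellipsoid P1.
    quad_form P2 (((\<lambda>y. A *v y + B *v sat (K *v y)) ^^ t) x) \<le> \<rho> * quad_form P1 x"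
proof -
  obtain \<rho> where \<rho>: "\<rho> < 1" "\<And>S x. quad_form P2 (E_map A B K H S t x) \<le> \<rho> * quad_form P1 x"
    using E_map_uniform_contraction[OF P1 less] by blast
  have "quad_form P2 (((\<lambda>y. A *v y + B *v sat (K *v y)) ^^ t) x) \<le> \<rho> * quad_form P1 x"
    if "x \<in> ellipsoid P1" for x
  proof -
    have "((\<lambda>y. A *v y + B *v sat (K *v y)) ^^ t) x \<in> convex hull (range (\<lambda>S. E_map A B K H S t x))"
      using region that in_lin_region_iff by (intro saturated_iterate_in_convex_hull) blast
    also have "\<dots> \<subseteq> {y. quad_form P2 y \<le> \<rho> * quad_form P1 x}"
      using \<rho>(2) by (intro hull_minimal convex_quad_form_sublevel P2) auto
    finally show ?thesis by simp
  qed
  with \<rho>(1) show ?thesis by blast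
qed

section \<open>Decay along switching signals\<close>

lemma trajectory_constant_mode:
  "(\<And>k. k < t \<Longrightarrow> \<sigma> (s + k) = i) \<Longrightarrow> trajectory f \<sigma> x0 (s + t) = (f i ^^ t) (trajectory f \<sigma> x0 s)"
  by (induction t) auto

text \<open>Time 0 counts as a switching instant, so the first switch is also preceded by \<open>\<tau>\<close> steps in the
  same mode.\<close>
lemma dwell_before_switch:
  assumes adm: "dt_admissible N \<tau> \<sigma>" and switch: "\<sigma> (Suc t) \<noteq> \<sigma> t"
  shows "\<tau> \<le> Suc t" "\<And>k. k < \<tau> \<Longrightarrow> \<sigma> (Suc t - \<tau> + k) = \<sigma> t"
proof -
  have inst: "Suc t \<in> switching_instants \<sigma>" "0 \<in> switching_instants \<sigma>"
    using switch by (simp_all add: switching_instants_def)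
  then show le: "\<tau> \<le> Suc t"
    using adm unfolding dt_admissible_def by (metis add_0 zero_less_Suc)
  have same_mode: "d < \<tau> \<Longrightarrow> \<sigma> (t - d) = \<sigma> t" for d
  proof (induction d)
    case (Suc d)
    have "t - d \<notin> switching_instants \<sigma>"
    proof
      assume "t - d \<in> switching_instants \<sigma>"
      then have "t - d + \<tau> \<le> Suc t"
        using adm inst unfolding dt_admissible_def by (metis diff_le_self le_imp_less_Suc)
      then show False using Suc.prems le by linarith
    qed
    then have "\<sigma> (t - d) = \<sigma> (t - d - 1)"
      by (auto simp: switching_instants_def)
    then show ?case using Suc by simp
  qed simp
  show "\<sigma> (Suc t - \<tau> + k) = \<sigma> t" if "k < \<tau>" for k
  proof -
    have "Suc t - \<tau> + k = t - (\<tau> - Suc k)" using that le by linarith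
    then show ?thesis using same_mode[of "\<tau> - Suc k"] that by simp
  qed
qed

text \<open>At time \<open>t\<close> the bound follows from the one at \<open>t - 1\<close> if the mode did not change, and from the
  one at \<open>t - \<tau>\<close> if it did. The induction also shows that the values stay at most 1, the region in
  which the two decrease hypotheses hold.\<close>
lemma multiple_lyapunov_decay:
  fixes V :: "nat \<Rightarrow> 'a \<Rightarrow> real"
  assumes adm: "dt_admissible N \<tau> \<sigma>" and \<tau>: "1 \<le> \<tau>" and r: "0 \<le> r" "r \<le> 1"
    and nonneg: "\<And>i x. i \<in> {1..N} \<Longrightarrow> 0 \<le> V i x"
    and step: "\<And>i x. i \<in> {1..N} \<Longrightarrow> V i x \<le> 1 \<Longrightarrow> V i (f i x) \<le> r * V i x"
    and switch: "\<And>i j x. i \<in> {1..N} \<Longrightarrow> j \<in> {1..N} \<Longrightarrow> i \<noteq> j \<Longrightarrow> V i x \<le> 1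
                  \<Longrightarrow> V j ((f i ^^ \<tau>) x) \<le> r ^ \<tau> * V i x"
    and init: "V (\<sigma> 0) x0 \<le> 1"
  shows "V (\<sigma> t) (trajectory f \<sigma> x0 t) \<le> r ^ t * V (\<sigma> 0) x0"
proof (induction t rule: less_induct)
  case (less t)
  have mode: "\<sigma> s \<in> {1..N}" for s using adm by (simp add: dt_admissible_def)
  have bound: "V (\<sigma> s) (trajectory f \<sigma> x0 s) \<le> 1" if "s < t" for s
  proof -
    have "r ^ s * V (\<sigma> 0) x0 \<le> 1"
      using r init nonneg[OF mode] by (intro mult_le_one power_le_one) auto
    then show ?thesis using less[OF that] by linarith
  qed
  have extend: "r ^ k * V (\<sigma> s) (trajectory f \<sigma> x0 s) \<le> r ^ (k + s) * V (\<sigma> 0) x0"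
    if "s < t" for s k
    using mult_left_mono[OF less[OF that], of "r ^ k"] r by (simp add: power_add mult.assoc)
  show ?case
  proof (cases t)
    case (Suc u)
    show ?thesis
    proof (cases "\<sigma> (Suc u) = \<sigma> u")
      case True
      then show ?thesis
        using step[OF mode bound, of u] extend[of u 1] Suc by simp
    next
      case False
      define s where "s = t - \<tau>"
      have s: "s + \<tau> = t" "s < t" "\<And>k. k < \<tau> \<Longrightarrow> \<sigma> (s + k) = \<sigma> u"
        using dwell_before_switch[OF adm False] \<tau> Suc by (auto simp: s_def)
      have traj: "trajectory f \<sigma> x0 t = (f (\<sigma> u) ^^ \<tau>) (trajectory f \<sigma> x0 s)"
        using trajectory_constant_mode[of \<tau> \<sigma> s "\<sigma> u" f x0] s by simp
      have su: "\<sigma> s = \<sigma> u" using s(3)[of 0] \<tau> by simp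
      have "V (\<sigma> t) (trajectory f \<sigma> x0 t) \<le> r ^ \<tau> * V (\<sigma> s) (trajectory f \<sigma> x0 s)"
        unfolding traj su using False Suc bound[OF s(2)] su
        by (intro switch mode) auto
      also have "\<dots> \<le> r ^ t * V (\<sigma> 0) x0"
        using extend[OF s(2), of \<tau>] s(1) by (simp add: add.commute)
      finally show ?thesis .
    qed
  qed simp
qed

lemma uniform_quad_form_bounds:
  assumes "finite I" "\<And>i. i \<in> I \<Longrightarrow> pos_def (P i)"
  shows "\<exists>c>0. \<exists>C>0. \<forall>i\<in>I. \<forall>x. c * (norm x)\<^sup>2 \<le> quad_form (P i) x \<and> quad_form (P i) x \<le> C * (norm x)\<^sup>2"
  using assms
proof (induction I rule: finite_induct)
  case empty
  show ?case by (auto intro: exI[of _ 1])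
next
  case (insert i I)
  then obtain c C where c: "c > 0" "C > 0" "\<forall>i\<in>I. \<forall>x. c * (norm x)\<^sup>2 \<le> quad_form (P i) x \<and> quad_form (P i) x \<le> C * (norm x)\<^sup>2"
    by auto
  obtain d where d: "d > 0" "\<forall>x. d * (norm x)\<^sup>2 \<le> quad_form (P i) x"
    using quad_form_lower_bound[of "P i"] insert.prems by auto
  obtain D where D: "D > 0" "\<forall>x. quad_form (P i) x \<le> D * (norm x)\<^sup>2"
    using quad_form_upper_bound[of "P i"] by auto
  have min: "min c d * (norm x)\<^sup>2 \<le> c * (norm x)\<^sup>2" "min c d * (norm x)\<^sup>2 \<le> d * (norm x)\<^sup>2"
    and max: "C * (norm x)\<^sup>2 \<le> max C D * (norm x)\<^sup>2" "D * (norm x)\<^sup>2 \<le> max C D * (norm x)\<^sup>2" for x :: "real^'b"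
    by (simp_all add: mult_right_mono)
  have "\<forall>k\<in>insert i I. \<forall>x. min c d * (norm x)\<^sup>2 \<le> quad_form (P k) x \<and> quad_form (P k) x \<le> max C D * (norm x)\<^sup>2"
    using c(3) d(2) D(2) by (auto intro: order_trans[OF min(1)] order_trans[OF min(2)]
        order_trans[OF _ max(1)] order_trans[OF _ max(2)])
  then show ?case using c d D by (intro exI[of _ "min c d"] conjI exI[of _ "max C D"]) auto
qed

lemma norm_tendsto_zero_of_geometric_bound:
  fixes X :: "nat \<Rightarrow> 'a::real_normed_vector"
  assumes "c > 0" "0 \<le> r" "r < 1" "\<And>t. c * (norm (X t))\<^sup>2 \<le> r ^ t * M"
  shows "X \<longlonglongrightarrow> 0"
proof -
  have "(\<lambda>t. r ^ t * (M / c)) \<longlonglongrightarrow> 0 * (M / c)"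
    using assms by (intro tendsto_mult_right LIMSEQ_realpow_zero)
  moreover have "(norm (X t))\<^sup>2 \<le> r ^ t * (M / c)" for t
    using assms(1) assms(4)[of t] by (simp add: field_simps)
  ultimately have "(\<lambda>t. (norm (X t))\<^sup>2) \<longlonglongrightarrow> 0"
    by (intro Lim_null_comparison[of "\<lambda>t. (norm (X t))\<^sup>2"]) simp_all
  then have "(\<lambda>t. sqrt ((norm (X t))\<^sup>2)) \<longlonglongrightarrow> sqrt 0"
    by (rule tendsto_real_sqrt)
  then show ?thesis by (simp add: tendsto_norm_zero_iff)
qed

text \<open>Since \<open>V\<close> is comparable to the squared norm, the decay of \<open>V\<close> is exponential decay of the state.
  A ball of radius \<open>1 / sqrt C\<close> lies in all sublevel sets \<open>V\<^sub>i \<le> 1\<close>, which gives local attraction.\<close>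
lemma dwell_time_stability:
  fixes V :: "nat \<Rightarrow> 'a::real_normed_vector \<Rightarrow> real"
  assumes \<tau>: "1 \<le> \<tau>" and r: "0 \<le> r" "r < 1" and c: "0 < c" "0 < C"
    and bounds: "\<And>i x. i \<in> {1..N} \<Longrightarrow> c * (norm x)\<^sup>2 \<le> V i x"
      "\<And>i x. i \<in> {1..N} \<Longrightarrow> V i x \<le> C * (norm x)\<^sup>2"
    and step: "\<And>i x. i \<in> {1..N} \<Longrightarrow> V i x \<le> 1 \<Longrightarrow> V i (f i x) \<le> r * V i x"
    and switch: "\<And>i j x. i \<in> {1..N} \<Longrightarrow> j \<in> {1..N} \<Longrightarrow> i \<noteq> j \<Longrightarrow> V i x \<le> 1
                  \<Longrightarrow> V j ((f i ^^ \<tau>) x) \<le> r ^ \<tau> * V i x"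
  shows "locally_asymptotically_stable_dt f N \<tau>"
    and "{x. \<forall>i\<in>{1..N}. V i x \<le> 1} \<subseteq> domain_of_attraction_dt f N \<tau>"
proof -
  have nonneg: "0 \<le> V i x" if "i \<in> {1..N}" for i x
    using bounds(1)[OF that, of x] c by (smt (verit, best) zero_le_power2 mult_nonneg_nonneg)
  have decay: "c * (norm (trajectory f \<sigma> x0 t))\<^sup>2 \<le> r ^ t * V (\<sigma> 0) x0"
    if "dt_admissible N \<tau> \<sigma>" "V (\<sigma> 0) x0 \<le> 1" for \<sigma> x0 t
  proof -
    have "V (\<sigma> t) (trajectory f \<sigma> x0 t) \<le> r ^ t * V (\<sigma> 0) x0"
      using multiple_lyapunov_decay[where V = V and f = f, OF that(1) \<tau> r(1) less_imp_le[OF r(2)]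
          nonneg step switch that(2)] .
    moreover have "\<sigma> t \<in> {1..N}" using that(1) by (simp add: dt_admissible_def)
    ultimately show ?thesis using bounds(1) order_trans by blast
  qed
  have attract: "trajectory f \<sigma> x0 \<longlonglongrightarrow> 0"
    if "dt_admissible N \<tau> \<sigma>" "V (\<sigma> 0) x0 \<le> 1" for \<sigma> x0
    by (rule norm_tendsto_zero_of_geometric_bound[OF c(1) r decay[OF that]])
  have mode: "\<sigma> 0 \<in> {1..N}" if "dt_admissible N \<tau> \<sigma>" for \<sigma>
    using that by (simp add: dt_admissible_def)
  then show "{x. \<forall>i\<in>{1..N}. V i x \<le> 1} \<subseteq> domain_of_attraction_dt f N \<tau>"
    using attract by (auto simp: domain_of_attraction_dt_def)
  have small: "V i x \<le> a" if "i \<in> {1..N}" "norm x < sqrt (a / C)" "0 < a" for i x a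
  proof -
    have "(norm x)\<^sup>2 \<le> (sqrt (a / C))\<^sup>2" using that by (intro power_mono) auto
    then have "C * (norm x)\<^sup>2 \<le> a" using that c by (simp add: field_simps)
    then show ?thesis using bounds(2)[OF that(1), of x] by linarith
  qed
  have "lyapunov_stable f \<sigma>" if adm: "dt_admissible N \<tau> \<sigma>" for \<sigma>
    unfolding lyapunov_stable_def
  proof (intro allI impI)
    fix \<epsilon> :: real assume \<epsilon>: "0 < \<epsilon>"
    \<comment> \<open>Level \<open>a\<close> is at most 1 for the decay to apply, and below \<open>c * \<epsilon>\<^sup>2\<close> to force the norm below \<open>\<epsilon>\<close>.\<close>
    define a where "a = min 1 (c * \<epsilon>\<^sup>2 / 2)"
    have a: "0 < a" "a \<le> 1" "a < c * \<epsilon>\<^sup>2" using c \<epsilon> by (auto simp: a_def min_def)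
    have "norm (trajectory f \<sigma> x0 t) < \<epsilon>" if "norm x0 < sqrt (a / C)" for x0 t
    proof -
      have V: "V (\<sigma> 0) x0 \<le> a" using small[OF mode[OF adm] that a(1)] .
      have "c * (norm (trajectory f \<sigma> x0 t))\<^sup>2 \<le> r ^ t * V (\<sigma> 0) x0"
        using V a by (intro decay adm) simp
      also have "\<dots> \<le> 1 * V (\<sigma> 0) x0"
        using r nonneg[OF mode[OF adm]] by (intro mult_right_mono power_le_one) auto
      also have "\<dots> < c * \<epsilon>\<^sup>2" using V a by simp
      finally show ?thesis using c \<epsilon> by (simp add: power2_less_imp_less)
    qed
    moreover have "0 < sqrt (a / C)" using a c by simp
    ultimately show "\<exists>\<delta>>0. \<forall>x0. norm x0 < \<delta> \<longrightarrow> (\<forall>t. norm (trajectory f \<sigma> x0 t) < \<epsilon>)" by blast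
  qed
  moreover have "\<exists>\<delta>>0. \<forall>x0. norm x0 < \<delta> \<longrightarrow> trajectory f \<sigma> x0 \<longlonglongrightarrow> 0"
    if adm: "dt_admissible N \<tau> \<sigma>" for \<sigma>
    using attract[OF adm small[OF mode[OF adm], of _ 1]] c by (intro exI[of _ "sqrt (1 / C)"]) auto
  ultimately show "locally_asymptotically_stable_dt f N \<tau>"
    by (simp add: locally_asymptotically_stable_dt_def)
qed

section \<open>Stability of the saturated switched system\<close>

theorem corollary1:
  fixes A :: "nat \<Rightarrow> real^'n^'n" and B :: "nat \<Rightarrow> real^'m^'n" and K :: "nat \<Rightarrow> real^'n^'m"
    and Q :: "nat \<Rightarrow> real^'n^'n" and Y :: "nat \<Rightarrow> nat \<Rightarrow> real^'n^'m"
    and N \<tau> :: nat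
  assumes "1 \<le> N" and "1 \<le> \<tau>"
    and "\<And>i. i \<in> {1..N} \<Longrightarrow> schur_stable (A i + B i ** K i)"
    and "asymptotically_stable_dt (unsaturated_system A B K) N \<tau>"
    and "\<And>i. i \<in> {1..N} \<Longrightarrow> pos_def (Q i)"
    and "\<And>i S. i \<in> {1..N} \<Longrightarrow>
      (let X = Theta0 (A i) (B i) (K i) S 1 ** Q i + Theta (A i) (B i) (K i) S 1 1 ** Y i 1
       in pos_def (block_matrix (Q i) (transpose X) X (Q i)))"
    and "\<And>i j S. i \<in> {1..N} \<Longrightarrow> j \<in> {1..N} \<Longrightarrow> i \<noteq> j \<Longrightarrow>
      (let X = Theta0 (A i) (B i) (K i) S \<tau> ** Q i
               + (\<Sum>r=1..\<tau>. Theta (A i) (B i) (K i) S r \<tau> ** Y i r)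
       in pos_def (block_matrix (Q i) (transpose X) X (Q j)))"
    and "\<And>i t j. i \<in> {1..N} \<Longrightarrow> t \<in> {1..\<tau>} \<Longrightarrow>
      (let y = (rowvector (row j (Y i t)) :: real^'n^1)
       in pos_semidef (block_matrix (mat 1) y (transpose y) (Q i)))"
  defines "P \<equiv> \<lambda>i. matrix_inv (Q i)"
    and "H \<equiv> \<lambda>i t. Y i t ** matrix_inv (Q i)"
  shows "locally_asymptotically_stable_dt (saturated_system A B K) N \<tau>
    \<and> (\<Inter>i\<in>{1..N}. ellipsoid (matrix_inv (Q i)))
        \<subseteq> domain_of_attraction_dt (saturated_system A B K) N \<tau>
    \<and> (\<forall>i\<in>{1..N}. \<forall>S x. x \<noteq> 0 \<longrightarrow>
        E_map (A i) (B i) (K i) (H i) S 1 x \<bullet> (P i *v E_map (A i) (B i) (K i) (H i) S 1 x)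
          < x \<bullet> (P i *v x))
    \<and> (\<forall>i\<in>{1..N}. \<forall>j\<in>{1..N}. i \<noteq> j \<longrightarrow> (\<forall>S x. x \<noteq> 0 \<longrightarrow>
        E_map (A i) (B i) (K i) (H i) S \<tau> x \<bullet> (P j *v E_map (A i) (B i) (K i) (H i) S \<tau> x)
          < x \<bullet> (P i *v x)))
    \<and> (\<forall>i\<in>{1..N}. \<forall>t\<in>{1..\<tau>}. ellipsoid (P i) \<subseteq> lin_region (H i t))"
proof -
  note pos_Q = assms(5)
  have pos_P: "pos_def (P i)" if "i \<in> {1..N}" for i
    using pos_def_matrix_inv[OF pos_Q[OF that]] by (simp add: P_def)
  have same: "quad_form (P i) (E_map (A i) (B i) (K i) (H i) S 1 x) < quad_form (P i) x"
    if "i \<in> {1..N}" "x \<noteq> 0" for i S x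
    unfolding P_def H_def using assms(6)[OF that(1), of S] that
    by (intro Theta_LMI_imp_E_map_less[OF pos_Q pos_Q refl]) (simp_all add: Let_def)
  have other: "quad_form (P j) (E_map (A i) (B i) (K i) (H i) S \<tau> x) < quad_form (P i) x"
    if "i \<in> {1..N}" "j \<in> {1..N}" "i \<noteq> j" "x \<noteq> 0" for i j S x
    unfolding P_def H_def using assms(7)[OF that(1-3), of S] that
    by (intro Theta_LMI_imp_E_map_less[OF pos_Q pos_Q refl]) (simp_all add: Let_def)
  have region: "ellipsoid (P i) \<subseteq> lin_region (H i t)" if "i \<in> {1..N}" "t \<in> {1..\<tau>}" for i t
    unfolding P_def H_def using assms(8)[OF that]
    by (intro row_LMI_imp_ellipsoid_subset pos_Q that(1)) (simp add: Let_def)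
  let ?f = "saturated_system A B K"
  \<comment> \<open>One step for the same mode and \<open>\<tau>\<close> steps across a switch, treated together to get one factor.\<close>
  define len where "len i j = (if i = j then 1 else \<tau>)" for i j :: nat
  have "\<exists>\<rho>. 0 < \<rho> \<and> \<rho> < 1 \<and> (\<forall>p\<in>{1..N} \<times> {1..N}. \<forall>x\<in>ellipsoid (P (fst p)).
      quad_form (P (snd p)) ((?f (fst p) ^^ len (fst p) (snd p)) x) \<le> \<rho> * quad_form (P (fst p)) x)"
  proof (rule uniform_contraction_factor)
    fix p assume p: "p \<in> {1..N} \<times> {1..N}"
    obtain i j where ij: "p = (i, j)" "i \<in> {1..N}" "j \<in> {1..N}" using p by auto
    have less: "quad_form (P j) (E_map (A i) (B i) (K i) (H i) S (len i j) x) < quad_form (P i) x"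
      if "x \<noteq> 0" for S x
      using same[OF ij(2) that] other[OF ij(2,3) _ that] unfolding len_def by (cases "i = j") simp_all
    have "ellipsoid (P i) \<subseteq> lin_region (H i r)" if "r \<in> {1..len i j}" for r
      using that \<open>1 \<le> \<tau>\<close> by (intro region ij) (auto simp: len_def split: if_splits)
    from saturated_iterate_contraction[OF pos_P pos_P less this] ij
    show "\<exists>\<rho><1. \<forall>x\<in>ellipsoid (P (fst p)).
        quad_form (P (snd p)) ((?f (fst p) ^^ len (fst p) (snd p)) x) \<le> \<rho> * quad_form (P (fst p)) x"
      by (simp add: saturated_system_def[abs_def])
  qed (auto intro!: pos_def_quad_form_nonneg pos_P)
  then obtain \<rho> where \<rho>: "0 < \<rho>" "\<rho> < 1"
    and contr: "\<And>i j x. i \<in> {1..N} \<Longrightarrow> j \<in> {1..N} \<Longrightarrow> quad_form (P i) x \<le> 1 \<Longrightarrow>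
      quad_form (P j) ((?f i ^^ len i j) x) \<le> \<rho> * quad_form (P i) x"
    by (auto simp: ellipsoid_def)
  \<comment> \<open>The rate per time step: \<open>\<tau>\<close> steps at rate \<open>r\<close> amount to \<open>\<rho>\<close>, and a single step in a fixed mode
    contracts by \<open>\<rho> \<le> r\<close>.\<close>
  define r where "r = root \<tau> \<rho>"
  have r: "0 \<le> r" "r < 1" "r ^ \<tau> = \<rho>"
    using \<rho> \<open>1 \<le> \<tau>\<close> by (auto simp: r_def)
  have "r ^ \<tau> \<le> r ^ 1" using r \<open>1 \<le> \<tau>\<close> by (intro power_decreasing) auto
  then have \<rho>_le: "\<rho> \<le> r" using r by simp
  have step: "quad_form (P i) (?f i x) \<le> r * quad_form (P i) x"
    if "i \<in> {1..N}" "quad_form (P i) x \<le> 1" for i x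
    using contr[OF that(1) that(1) that(2)]
      mult_right_mono[OF \<rho>_le pos_def_quad_form_nonneg[OF pos_P[OF that(1)], of x]]
    by (simp add: len_def)
  have switch: "quad_form (P j) ((?f i ^^ \<tau>) x) \<le> r ^ \<tau> * quad_form (P i) x"
    if "i \<in> {1..N}" "j \<in> {1..N}" "i \<noteq> j" "quad_form (P i) x \<le> 1" for i j x
    using contr[OF that(1,2,4)] that(3) r(3) by (simp add: len_def)
  obtain c C where c: "0 < c" "0 < C"
    and bounds: "\<And>i x. i \<in> {1..N} \<Longrightarrow> c * (norm x)\<^sup>2 \<le> quad_form (P i) x"
      "\<And>i x. i \<in> {1..N} \<Longrightarrow> quad_form (P i) x \<le> C * (norm x)\<^sup>2"
    using uniform_quad_form_bounds[of "{1..N}" P] pos_P by auto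
  note stab = dwell_time_stability[where V = "\<lambda>i. quad_form (P i)" and f = ?f,
      OF \<open>1 \<le> \<tau>\<close> r(1,2) c bounds step switch]
  have "(\<Inter>i\<in>{1..N}. ellipsoid (matrix_inv (Q i))) = {x. \<forall>i\<in>{1..N}. quad_form (P i) x \<le> 1}"
    by (auto simp: ellipsoid_def P_def)
  then show ?thesis
    using stab same other region by simp
qed

end
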